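(* Let $f\colon\mathbb R^n\to\mathbb R$ and $F\colon\mathbb R^n\to\mathbb R^m$ be twice continuously differentiable, let $D_1,\ldots,D_r\subset\mathbb R^m$ be polyhedral sets, $D:=\bigcup_{i=1}^r D_i$, and $X:=\{x\in\mathbb R^n\,|\,F(x)\in D\}$. Let $\bar x\in X$ be a locally optimal solution of the problem of minimizing $f(x)$ subject to $F(x)\in D$, and suppose that MPDC-LICQ is valid at $\bar x$. Then \[ \forall d\in\mathcal C_X(\bar x)\colon\quad d^\top\nabla^2_{xx}L(\bar x,\bar\lambda)\,d\ge 0, \] where $\bar\lambda$ is the uniquely determined element of $S(\bar x)$.
   Context: A set is polyhedral if it is the intersection of finitely many (closed) half spaces. $\nabla F(x)\in\mathbb R^{m\times n}$ denotes the Jacobian, $\nabla f(x)$ the gradient (a column vector). For a closed set $A\subset\mathbb R^m$ and $y\in A$, the tangent (Bouligand) cone is $\mathcal T_A(y):=\{d\,|\,\exists t_k\downarrow 0,\ \exists d_k\to d:\ y+t_kd_k\in A\ \forall k\}$, and the Fréchet normal cone is $\widehat{\mathcal N}_A(y):=\{\eta\,|\,\eta\cdot d\le 0\ \forall d\in\mathcal T_A(y)\}$. For $\bar x\in X$, $I(\bar x):=\{i\in\{1,\ldots,r\}\,|\,F(\bar x)\in D_i\}$. MPDC-LICQ holds at $\bar x\in X$ if the only vector $\lambda\in\sum_{i\in I(\bar x)}\operatorname{span}\widehat{\mathcal N}_{D_i}(F(\bar x))$ with $\nabla F(\bar x)^\top\lambda=0$ is $\lambda=0$. The Lagrangian is $L(x,\lambda):=f(x)+F(x)\cdot\lambda$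 for $(x,\lambda)\in\mathbb R^n\times\mathbb R^m$. The linearization cone is $\mathcal L_X(\bar x):=\{d\in\mathbb R^n\,|\,\nabla F(\bar x)d\in\mathcal T_D(F(\bar x))\}$ and the critical cone is $\mathcal C_X(\bar x):=\{d\in\mathcal L_X(\bar x)\,|\,\nabla f(\bar x)\cdot d\le 0\}$. The set of S-stationarity multipliers is $S(\bar x):=\{\lambda\in\bigcap_{i\in I(\bar x)}\widehat{\mathcal N}_{D_i}(F(\bar x))\,|\,\nabla_xL(\bar x,\lambda)=0\}$; at a local minimizer where MPDC-LICQ is valid, this set has exactly one element. *)

theory Defs
  imports "HOL-Analysis.Analysis" "HOL-Library.Set_Algebras"
begin

definition twice_cont_differentiable ::
    "('a::real_normed_vector \<Rightarrow> 'b::real_normed_vector) \<Rightarrow> bool" where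
  "twice_cont_differentiable f \<longleftrightarrow>
     (\<exists>(f' :: 'a \<Rightarrow> 'a \<Rightarrow>\<^sub>L 'b) (f'' :: 'a \<Rightarrow> 'a \<Rightarrow>\<^sub>L ('a \<Rightarrow>\<^sub>L 'b)).
        (\<forall>x. (f has_derivative blinfun_apply (f' x)) (at x)) \<and>
        (\<forall>x. (f' has_derivative blinfun_apply (f'' x)) (at x)) \<and>
        continuous_on UNIV f'')"

definition gradient :: "('a::real_inner \<Rightarrow> real) \<Rightarrow> 'a \<Rightarrow> 'a" where
  "gradient f x = (THE g. GDERIV f x :> g)"

definition hessian :: "(real ^ 'n \<Rightarrow> real) \<Rightarrow> real ^ 'n \<Rightarrow> real ^ 'n ^ 'n" where
  "hessian f x = jacobian (gradient f) (at x)"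

text \<open>As usual, \<open>t\<^sub>k \<down> 0\<close> means a null sequence of positive reals; monotonicity
  is not demanded (it can always be achieved by passing to a subsequence).\<close>

definition tangent_cone :: "'a::real_normed_vector set \<Rightarrow> 'a \<Rightarrow> 'a set" where
  "tangent_cone A y =
     {d. \<exists>(t :: nat \<Rightarrow> real) (e :: nat \<Rightarrow> 'a).
           (\<forall>k. t k > 0) \<and> t \<longlonglongrightarrow> 0 \<and> e \<longlonglongrightarrow> d \<and> (\<forall>k. y + t k *\<^sub>R e k \<in> A)}"

definition frechet_normal_cone :: "'a::real_inner set \<Rightarrow> 'a \<Rightarrow> 'a set" where
  "frechet_normal_cone A y = {\<eta>. \<forall>d\<in>tangent_cone A y. \<eta> \<bullet> d \<le> 0}"

text \<open>The disjunctive constraint is given by \<open>F x \<in> D 1 \<union> \<dots> \<union> D r\<close>; only the values of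
  \<open>D\<close> on \<open>{1..r}\<close> matter.\<close>

definition disj_union :: "nat \<Rightarrow> (nat \<Rightarrow> 'b set) \<Rightarrow> 'b set" where
  "disj_union r D = (\<Union>i\<in>{1..r}. D i)"

definition feasible_set :: "('a \<Rightarrow> 'b) \<Rightarrow> nat \<Rightarrow> (nat \<Rightarrow> 'b set) \<Rightarrow> 'a set" where
  "feasible_set F r D = {x. F x \<in> disj_union r D}"

definition active_indices :: "('a \<Rightarrow> 'b) \<Rightarrow> nat \<Rightarrow> (nat \<Rightarrow> 'b set) \<Rightarrow> 'a \<Rightarrow> nat set" where
  "active_indices F r D x = {i\<in>{1..r}. F x \<in> D i}"

definition local_minimizer_on :: "('a::metric_space \<Rightarrow> real) \<Rightarrow> 'a set \<Rightarrow> 'a \<Rightarrow> bool" where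
  "local_minimizer_on f X x \<longleftrightarrow>
     x \<in> X \<and> (\<exists>\<epsilon>>0. \<forall>y\<in>X \<inter> ball x \<epsilon>. f x \<le> f y)"

text \<open>The sum below is the Minkowski sum of sets from \<open>Set_Algebras\<close>.\<close>

definition MPDC_LICQ ::
    "(real ^ 'n \<Rightarrow> real ^ 'm) \<Rightarrow> nat \<Rightarrow> (nat \<Rightarrow> (real ^ 'm) set) \<Rightarrow> real ^ 'n \<Rightarrow> bool" where
  "MPDC_LICQ F r D x \<longleftrightarrow>
     (\<forall>l \<in> (\<Sum>i\<in>active_indices F r D x. span (frechet_normal_cone (D i) (F x))).
        transpose (jacobian F (at x)) *v l = 0 \<longrightarrow> l = 0)"

definition lagrangian ::
    "('a \<Rightarrow> real) \<Rightarrow> ('a \<Rightarrow> 'b::real_inner) \<Rightarrow> 'a \<Rightarrow> 'b \<Rightarrow> real" where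
  "lagrangian f F x l = f x + F x \<bullet> l"

definition linearization_cone ::
    "(real ^ 'n \<Rightarrow> real ^ 'm) \<Rightarrow> nat \<Rightarrow> (nat \<Rightarrow> (real ^ 'm) set) \<Rightarrow> real ^ 'n \<Rightarrow> (real ^ 'n) set" where
  "linearization_cone F r D x =
     {d. jacobian F (at x) *v d \<in> tangent_cone (disj_union r D) (F x)}"

definition critical_cone ::
    "(real ^ 'n \<Rightarrow> real) \<Rightarrow> (real ^ 'n \<Rightarrow> real ^ 'm) \<Rightarrow> nat \<Rightarrow> (nat \<Rightarrow> (real ^ 'm) set) \<Rightarrow>
      real ^ 'n \<Rightarrow> (real ^ 'n) set" where
  "critical_cone f F r D x = {d \<in> linearization_cone F r D x. gradient f x \<bullet> d \<le> 0}"

definition S_multipliers ::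
    "(real ^ 'n \<Rightarrow> real) \<Rightarrow> (real ^ 'n \<Rightarrow> real ^ 'm) \<Rightarrow> nat \<Rightarrow> (nat \<Rightarrow> (real ^ 'm) set) \<Rightarrow>
      real ^ 'n \<Rightarrow> (real ^ 'm) set" where
  "S_multipliers f F r D x =
     {l \<in> (\<Inter>i\<in>active_indices F r D x. frechet_normal_cone (D i) (F x)).
        gradient (\<lambda>z. lagrangian f F z l) x = 0}"

end

theory Submission
  imports Defs
begin

text \<open>Let \<open>V\<close> be the sum of the spans of the normal cones to the active \<open>D\<^sub>i\<close> at \<open>F xbar\<close> and \<open>A\<close> the
  Jacobian. By MPDC-LICQ the transpose of \<open>A\<close> is injective on \<open>V\<close>, so the inverse function theorem
  gives, for each direction \<open>d\<close>, a curve \<open>g t = xbar + t d + o(t)\<close> with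
  \<open>v \<bullet> (F (g t) - F xbar) = t (v \<bullet> A d)\<close> for all \<open>v \<in> V\<close>. Near \<open>F xbar\<close> the polyhedron \<open>D\<^sub>i\<close> is cut out
  by finitely many normals from \<open>V\<close>, so the curve is feasible whenever \<open>A d\<close> is tangent to \<open>D\<^sub>i\<close>.
  Minimality along these curves and Farkas' lemma give a multiplier for each active \<open>i\<close>; all of them
  lie in \<open>V\<close> and hence coincide. If \<open>d\<close> is critical, then \<open>l \<bullet> A d = 0\<close> for the multiplier \<open>l\<close>, so
  \<open>l \<bullet> F\<close> is constant along the curve and \<open>xbar\<close> minimizes the Lagrangian along it. Since the
  gradient of the Lagrangian vanishes at \<open>xbar\<close>, its Hessian is nonnegative at \<open>d\<close>.\<close>

section \<open>Gradients and Hessians in terms of bounded linear derivatives\<close>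

text \<open>\<open>gradient\<close> is a definite description: \<open>g\<close>, assembled from the
  values of \<open>h'\<close> on the basis, represents \<open>h'\<close>, and uniqueness of
  derivatives shows that no other vector does.\<close>

lemma gradient_inner:
  assumes "(h has_derivative blinfun_apply h') (at (x :: 'a::euclidean_space))"
  shows "gradient h x \<bullet> v = blinfun_apply h' v"
proof -
  define g where "g = (\<Sum>b\<in>Basis. blinfun_apply h' b *\<^sub>R b)"
  have g: "v \<bullet> g = blinfun_apply h' v" for v
  proof -
    have "blinfun_apply h' v = blinfun_apply h' (\<Sum>b\<in>Basis. (v \<bullet> b) *\<^sub>R b)"
      by (simp add: euclidean_representation)
    also have "\<dots> = (\<Sum>b\<in>Basis. (v \<bullet> b) * blinfun_apply h' b)"
      by (simp add: blinfun.sum_right blinfun.scaleR_right)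
    finally show ?thesis
      by (simp add: g_def inner_sum_right mult.commute)
  qed
  have "gradient h x = g"
    unfolding gradient_def gderiv_def
  proof (rule the_equality)
    show "(h has_derivative (\<lambda>v. v \<bullet> g)) (at x)"
      using assms by (simp add: g)
  next
    fix k assume "(h has_derivative (\<lambda>v. v \<bullet> k)) (at x)"
    then have "(\<lambda>v. v \<bullet> k) = blinfun_apply h'"
      using assms has_derivative_unique by blast
    then have "v \<bullet> k = v \<bullet> g" for v
      by (metis g)
    then show "k = g"
      using vector_eq_ldot by blast
  qed
  then show ?thesis
    using g[of v] by (simp add: inner_commute)
qed

text \<open>The map \<open>R\<close> sending a functional to its representing vector is bounded
  linear, so \<open>gradient h\<close> is \<open>R\<close> after \<open>h'\<close> and has the
  derivative \<open>R\<close> after \<open>h''\<close>. Uniqueness of derivatives identifies this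
  with the Hessian matrix.\<close>

lemma hessian_inner:
  fixes h :: "real ^ 'n \<Rightarrow> real"
  assumes h: "\<And>z. (h has_derivative blinfun_apply (h' z)) (at z)"
    and h': "(h' has_derivative h'') (at x)"
  shows "d \<bullet> (hessian h x *v e) = blinfun_apply (h'' e) d"
proof -
  define R :: "((real ^ 'n) \<Rightarrow>\<^sub>L real) \<Rightarrow> real ^ 'n"
    where "R L = (\<Sum>b\<in>Basis. blinfun_apply L b *\<^sub>R b)" for L
  have R: "R L \<bullet> b = blinfun_apply L b" if "b \<in> Basis" for L b
    using that unfolding R_def by simp
  have blR: "bounded_linear R"
    unfolding R_def
    by (rule bounded_linear_sum, rule bounded_linear_scaleR_const, rule blinfun.bounded_linear_left)
  have "gradient h = (\<lambda>z. R (h' z))"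
    by (rule ext, rule euclidean_eqI) (simp add: R gradient_inner[OF h])
  moreover have "((\<lambda>z. R (h' z)) has_derivative (\<lambda>e. R (h'' e))) (at x)"
    using blR h' by (rule bounded_linear.has_derivative)
  ultimately have D: "(gradient h has_derivative (\<lambda>e. R (h'' e))) (at x)"
    by simp
  then have "gradient h differentiable (at x)"
    by (auto simp: differentiable_def)
  then have "(gradient h has_derivative (\<lambda>e. hessian h x *v e)) (at x)"
    unfolding hessian_def jacobian_works by blast
  then have "(\<lambda>e. hessian h x *v e) = (\<lambda>e. R (h'' e))"
    using D has_derivative_unique by blast
  then have "hessian h x *v e = R (h'' e)"
    by metis
  moreover have "d \<bullet> R L = blinfun_apply L d" for L
  proof -
    have "blinfun_apply L d = blinfun_apply L (\<Sum>b\<in>Basis. (d \<bullet> b) *\<^sub>R b)"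
      by (simp add: euclidean_representation)
    then show ?thesis
      by (simp add: R_def blinfun.sum_right blinfun.scaleR_right inner_sum_right mult.commute)
  qed
  ultimately show ?thesis by simp
qed

section \<open>Local geometry of polyhedra, tangent cones and normal cones\<close>

text \<open>\<open>J\<close> consists of the normals of those half spaces that have \<open>y\<close>
  on their boundary. The other inequalities are strict at \<open>y\<close> and hence, by continuity,
  hold near \<open>y\<close> without further conditions.\<close>

lemma polyhedron_active_normals:
  fixes P :: "'a::euclidean_space set"
  assumes "polyhedron P" "y \<in> P"
  obtains J where "finite J"
    and "J \<subseteq> frechet_normal_cone P y"
    and "\<forall>\<^sub>F z in nhds y. (\<forall>a\<in>J. a \<bullet> (z - y) \<le> 0) \<longrightarrow> z \<in> P"
proof -
  obtain H where "finite H" and P: "P = \<Inter>H"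
    and "\<forall>h\<in>H. \<exists>a b. a \<noteq> 0 \<and> h = {x. a \<bullet> x \<le> b}"
    using \<open>polyhedron P\<close> unfolding polyhedron_def by blast
  then obtain a b where ab: "\<And>h. h \<in> H \<Longrightarrow> h = {x. a h \<bullet> x \<le> b h}"
    by metis
  define J where "J = a ` {h \<in> H. a h \<bullet> y = b h}"
  show thesis
  proof
    show "finite J"
      using \<open>finite H\<close> by (simp add: J_def)
  next
    have "c \<bullet> d \<le> 0" if "c \<in> J" "d \<in> tangent_cone P y" for c d
    proof -
      from that obtain h t e where h: "h \<in> H" "c = a h" "a h \<bullet> y = b h"
        and t: "\<And>k::nat. t k > (0::real)" and e: "e \<longlonglongrightarrow> d"
        and in_P: "\<And>k. y + t k *\<^sub>R e k \<in> P"
        by (auto simp: J_def tangent_cone_def)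
      have "c \<bullet> e k \<le> 0" for k
      proof -
        have "y + t k *\<^sub>R e k \<in> h"
          using in_P h(1) P by blast
        then have "a h \<bullet> (y + t k *\<^sub>R e k) \<le> b h"
          using ab[OF h(1)] by blast
        then have "t k * (c \<bullet> e k) \<le> 0"
          using h by (simp add: inner_add_right)
        then show ?thesis
          using t[of k] by (simp add: mult_le_0_iff)
      qed
      moreover have "(\<lambda>k. c \<bullet> e k) \<longlonglongrightarrow> c \<bullet> d"
        using e by (intro tendsto_intros)
      ultimately show "c \<bullet> d \<le> 0"
        by (metis LIMSEQ_le_const2)
    qed
    then show "J \<subseteq> frechet_normal_cone P y"
      by (auto simp: frechet_normal_cone_def)
  next
    have "\<forall>\<^sub>F z in nhds y. (\<forall>c\<in>J. c \<bullet> (z - y) \<le> 0) \<longrightarrow> z \<in> h" if "h \<in> H" for h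
    proof (cases "a h \<bullet> y = b h")
      case True
      then have "a h \<in> J"
        using that by (auto simp: J_def)
      then have "(\<forall>c\<in>J. c \<bullet> (z - y) \<le> 0) \<longrightarrow> z \<in> h" for z
        using True by (subst ab[OF that]) (auto simp: inner_diff_right)
      then show ?thesis
        by (simp add: always_eventually)
    next
      case False
      moreover have "y \<in> h"
        using \<open>y \<in> P\<close> P that by blast
      then have "a h \<bullet> y \<le> b h"
        using ab[OF that] by blast
      ultimately have "a h \<bullet> y < b h"
        by simp
      then have "\<forall>\<^sub>F z in nhds y. a h \<bullet> z < b h"
        by (intro order_tendstoD(2)[of _ "a h \<bullet> y"] tendsto_intros filterlim_ident)
      moreover have "z \<in> h" if "a h \<bullet> z < b h" for z
        using that ab[OF \<open>h \<in> H\<close>] less_imp_le by blast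
      ultimately show ?thesis
        by (auto elim!: eventually_mono)
    qed
    then have "\<forall>\<^sub>F z in nhds y. \<forall>h\<in>H. (\<forall>c\<in>J. c \<bullet> (z - y) \<le> 0) \<longrightarrow> z \<in> h"
      by (intro eventually_ball_finite \<open>finite H\<close> ballI)
    then show "\<forall>\<^sub>F z in nhds y. (\<forall>c\<in>J. c \<bullet> (z - y) \<le> 0) \<longrightarrow> z \<in> P"
      by eventually_elim (auto simp: P)
  qed
qed

text \<open>By the pigeonhole principle a single \<open>D i\<close> contains infinitely many points
  of the sequence witnessing tangency. The corresponding subsequence converges to \<open>y\<close>
  and witnesses tangency to \<open>D i\<close>; closedness puts \<open>y\<close> into
  \<open>D i\<close>.\<close>

lemma tangent_cone_disj_union:
  fixes D :: "nat \<Rightarrow> 'a::real_normed_vector set"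
  assumes "\<And>i. i \<in> {1..r} \<Longrightarrow> closed (D i)"
    and "v \<in> tangent_cone (disj_union r D) y"
  obtains i where "i \<in> {1..r}" "y \<in> D i" "v \<in> tangent_cone (D i) y"
proof -
  obtain t e where t: "\<And>k::nat. t k > (0::real)" "t \<longlonglongrightarrow> 0" and e: "e \<longlonglongrightarrow> v"
    and inD: "\<And>k. y + t k *\<^sub>R e k \<in> disj_union r D"
    using assms(2) by (auto simp: tangent_cone_def)
  have "\<exists>i\<in>{1..r}. infinite {k\<in>UNIV. y + t k *\<^sub>R e k \<in> D i}"
    using inD by (intro pigeonhole_infinite_rel) (auto simp: disj_union_def)
  then obtain i where i: "i \<in> {1..r}" and "infinite {k. y + t k *\<^sub>R e k \<in> D i}"
    by auto
  then obtain s :: "nat \<Rightarrow> nat" where s: "strict_mono s" and sD: "\<And>k. y + t (s k) *\<^sub>R e (s k) \<in> D i"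
    using infinite_enumerate by (metis (no_types, lifting) mem_Collect_eq)
  have t': "(\<lambda>k. t (s k)) \<longlonglongrightarrow> 0" and e': "(\<lambda>k. e (s k)) \<longlonglongrightarrow> v"
    using LIMSEQ_subseq_LIMSEQ[OF _ s] t(2) e by (auto simp: o_def)
  have "(\<lambda>k. y + t (s k) *\<^sub>R e (s k)) \<longlonglongrightarrow> y + 0 *\<^sub>R v"
    by (intro tendsto_intros t' e')
  then have "y \<in> D i"
    using closed_sequentially[OF assms(1)[OF i], of "\<lambda>k. y + t (s k) *\<^sub>R e (s k)"] sD by auto
  moreover have "v \<in> tangent_cone (D i) y"
    unfolding tangent_cone_def using t(1) t' e' sD
    by (intro CollectI exI[of _ "\<lambda>k. t (s k)"] exI[of _ "\<lambda>k. e (s k)"]) auto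
  ultimately show thesis
    using that i by blast
qed

lemma convex_cone_frechet_normal_cone: "convex_cone (frechet_normal_cone A y)"
  by (auto simp: convex_cone_iff frechet_normal_cone_def inner_add_left
      intro: add_nonpos_nonpos mult_nonneg_nonpos)

lemma subspace_sum_subspaces:
  assumes "finite I" "\<And>i. i \<in> I \<Longrightarrow> subspace (S i)"
  shows "subspace (\<Sum>i\<in>I. S i)"
  using assms
proof (induction I rule: finite_induct)
  case (insert i I)
  then have "subspace {x + y |x y. x \<in> S i \<and> y \<in> (\<Sum>j\<in>I. S j)}"
    by (intro subspace_sums) auto
  moreover have "{x + y |x y. x \<in> S i \<and> y \<in> (\<Sum>j\<in>I. S j)} = S i + (\<Sum>j\<in>I. S j)"
    by (auto simp: set_plus_def)
  ultimately show ?case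
    using insert by simp
qed (simp add: subspace_single_0)

lemma subset_sum_subspaces:
  assumes "finite I" "\<And>i. i \<in> I \<Longrightarrow> subspace (S i)" "i \<in> I"
  shows "S i \<subseteq> (\<Sum>j\<in>I. S j)"
proof
  fix x assume "x \<in> S i"
  have "0 \<in> (\<Sum>j\<in>I - {i}. S j)"
    using assms by (intro subspace_0 subspace_sum_subspaces) auto
  then have "x + 0 \<in> S i + (\<Sum>j\<in>I - {i}. S j)"
    using \<open>x \<in> S i\<close> by (intro set_plus_intro)
  then show "x \<in> (\<Sum>j\<in>I. S j)"
    using assms by (simp add: sum.remove)
qed

section \<open>Farkas' lemma\<close>

text \<open>A finitely generated convex cone is closed, so a hyperplane strictly separates
  \<open>c\<close> from it. Invariance under positive scaling forces the separating functional to be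
  nonnegative on the cone; the direction sought is its negative.\<close>

lemma farkas:
  fixes J :: "'a::euclidean_space set"
  assumes "finite J" "c \<notin> convex_cone hull J"
  obtains d where "\<And>a. a \<in> J \<Longrightarrow> a \<bullet> d \<le> 0" "c \<bullet> d > 0"
proof -
  let ?C = "convex_cone hull J"
  obtain e b where e: "e \<bullet> c < b" and b: "\<And>x. x \<in> ?C \<Longrightarrow> e \<bullet> x > b"
    using separating_hyperplane_closed_point[OF convex_convex_cone_hull
        closed_convex_cone_hull[OF assms(1)] assms(2)] by blast
  have "b < 0"
    using b[OF convex_cone_hull_contains_0] by simp
  show thesis
  proof
    show "c \<bullet> (- e) > 0"
      using e \<open>b < 0\<close> by (simp add: inner_commute)
  next
    fix a assume "a \<in> J"
    show "a \<bullet> (- e) \<le> 0"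
    proof (rule ccontr)
      assume "\<not> a \<bullet> (- e) \<le> 0"
      then have neg: "e \<bullet> a < 0"
        by (simp add: inner_commute)
      \<comment> \<open>The factor is positive, being a quotient of two negative numbers, and is
        chosen so that \<open>e\<close> takes exactly the value \<open>b\<close> at this multiple,
        contrary to the strict bound on the cone.\<close>
      have "(b / (e \<bullet> a)) *\<^sub>R a \<in> ?C"
        using \<open>a \<in> J\<close> neg \<open>b < 0\<close>
        by (intro convex_cone_hull_mul hull_inc) (auto simp: divide_nonpos_neg)
      from b[OF this] show False
        using neg by simp
    qed
  qed
qed

section \<open>Curves with prescribed components of the constraint map\<close>

text \<open>The adjoint of \<open>?A\<close> is injective on \<open>V\<close> and so has a linear
  left inverse \<open>S\<close> there. The adjoint \<open>R\<close> of \<open>S\<close> is then a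
  right inverse of \<open>?A\<close> as far as inner products with \<open>V\<close> can tell, and it
  is used to correct the nonlinear part of \<open>F\<close>.\<close>

lemma curve_with_prescribed_components:
  fixes F :: "'a::euclidean_space \<Rightarrow> 'b::euclidean_space" and F' :: "'a \<Rightarrow> 'a \<Rightarrow>\<^sub>L 'b"
  assumes F: "\<And>x. (F has_derivative blinfun_apply (F' x)) (at x)"
    and F': "continuous_on UNIV F'"
    and V: "subspace V" "\<And>v. v \<in> V \<Longrightarrow> adjoint (blinfun_apply (F' x0)) v = 0 \<Longrightarrow> v = 0"
  obtains g :: "real \<Rightarrow> 'a" where
    "((\<lambda>t. (g t - x0) /\<^sub>R t) \<longlongrightarrow> d) (at_right 0)"
    "\<forall>\<^sub>F t in at_right 0. \<forall>v\<in>V. v \<bullet> (F (g t) - F x0) = t * (v \<bullet> blinfun_apply (F' x0) d)"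
proof -
  let ?A = "blinfun_apply (F' x0)"
  have linA: "linear ?A"
    by (simp add: blinfun.bounded_linear_right bounded_linear.linear)
  have linAt: "linear (adjoint ?A)"
    using adjoint_linear[OF linA] .
  have span_V: "span V = V"
    using V(1) by (simp add: span_eq_iff)
  have "inj_on (adjoint ?A) (span V)"
    unfolding span_V
  proof (rule inj_onI)
    fix v w assume "v \<in> V" "w \<in> V" "adjoint ?A v = adjoint ?A w"
    then have "adjoint ?A (v - w) = 0" "v - w \<in> V"
      using V(1) by (auto simp: linear_diff[OF linAt] subspace_diff)
    then show "v = w"
      using V(2) by force
  qed
  then obtain S where S: "linear S" "\<And>v. v \<in> V \<Longrightarrow> S (adjoint ?A v) = v"
    using linear_inj_on_left_inverse[OF linAt, of V] span_V by auto
  define R where "R = Blinfun (adjoint S)"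
  have R: "blinfun_apply R = adjoint S"
    unfolding R_def using adjoint_linear[OF S(1)]
    by (intro bounded_linear_Blinfun_apply) (simp add: linear_conv_bounded_linear)
  have AR: "v \<bullet> ?A (R w) = v \<bullet> w" if "v \<in> V" for v w
  proof -
    have "v \<bullet> ?A (R w) = R w \<bullet> adjoint ?A v"
      by (simp add: adjoint_works[OF linA] inner_commute)
    also have "\<dots> = w \<bullet> S (adjoint ?A v)"
      by (simp add: R adjoint_clauses[OF S(1)])
    finally show ?thesis
      using S(2)[OF that] by (simp add: inner_commute)
  qed
  txt \<open>Applying \<open>v \<bullet> ?A\<close> to \<open>G x\<close> yields \<open>v \<bullet> (F x - F x0)\<close>, while the derivative of \<open>G\<close> at \<open>x0\<close> is
    the identity; hence the local inverse of \<open>G\<close> maps the ray through \<open>d\<close> to the desired curve.\<close>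
  define G where "G x = (x - x0) + R (F x - F x0 - ?A (x - x0))" for x
  define G' where "G' x = id_blinfun + (R o\<^sub>L (F' x - F' x0))" for x
  have G: "(G has_derivative blinfun_apply (G' x)) (at x)" for x
    unfolding G_def G'_def
    by (intro derivative_eq_intros F refl)
       (auto simp: blinfun.add_left blinfun.diff_left blinfun.diff_right blinfun.zero_left
         intro!: derivative_eq_intros F)
  have contG: "continuous_on UNIV G'"
    unfolding G'_def by (intro continuous_intros F')
  have "id_blinfun o\<^sub>L G' x0 = id_blinfun"
    by (auto simp: G'_def intro!: blinfun_eqI)
  with G contG obtain U' W h h' where W: "open W" "G x0 \<in> W" "x0 \<in> U'"
    and hom: "homeomorphism U' W G h"
    and h: "\<And>y. y \<in> W \<Longrightarrow> (h has_derivative h' y) (at y)"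
    and h': "\<And>y. y \<in> W \<Longrightarrow> h' y = inv (blinfun_apply (G' (h y)))"
    using inverse_function_theorem[of UNIV G G' x0 id_blinfun] by (metis UNIV_I open_UNIV)
  have G0: "G x0 = 0"
    by (simp add: G_def)
  have h0: "h 0 = x0"
    using hom W(3) G0 by (metis homeomorphism_apply1)
  have "G' x0 = id_blinfun"
    by (simp add: G'_def)
  \<comment> \<open>Since \<open>h\<close> inverts \<open>G\<close> locally, its derivative at
    \<open>G x0 = 0\<close> is the inverse of the identity; this gives the curve the velocity
    \<open>d\<close> at \<open>x0\<close>.\<close>
  then have "h' 0 = id"
    using h'[of 0] W(2) G0 h0 by (simp add: id_def[symmetric])
  then have h_der: "(h has_derivative id) (at 0)"
    using h[of 0] W(2) G0 by simp
  define g where "g t = h (t *\<^sub>R d)" for t :: real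
  show thesis
  proof
    have "(h has_derivative id) (at (0 *\<^sub>R d))"
      using h_der by simp
    then have "(g has_derivative (\<lambda>t. t *\<^sub>R d)) (at 0)"
      unfolding g_def
      using has_derivative_compose[of "\<lambda>t. t *\<^sub>R d" "\<lambda>t. t *\<^sub>R d" 0 UNIV h id]
      by (simp add: bounded_linear_imp_has_derivative bounded_linear_scaleR_left)
    then have "((\<lambda>t. norm (g t - g 0 - (t - 0) *\<^sub>R d) / norm (t - 0)) \<longlongrightarrow> 0) (at 0)"
      unfolding has_derivative_iff_norm by blast
    moreover
    have "norm (g t - g 0 - (t - 0) *\<^sub>R d) / norm (t - 0) = norm ((g t - x0) /\<^sub>R t - d)"
      if "t \<noteq> 0" for t
    proof -
      have "(g t - x0) /\<^sub>R t - d = (g t - x0 - t *\<^sub>R d) /\<^sub>R t"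
        using that by (simp add: scaleR_diff_right)
      then show ?thesis
        by (simp add: g_def h0 divide_inverse mult.commute)
    qed
    then have "\<forall>\<^sub>F t in at 0. norm (g t - g 0 - (t - 0) *\<^sub>R d) / norm (t - 0) =
        norm ((g t - x0) /\<^sub>R t - d)"
      unfolding eventually_at_filter by (intro always_eventually) blast
    ultimately have "((\<lambda>t. norm ((g t - x0) /\<^sub>R t - d)) \<longlongrightarrow> 0) (at 0)"
      by (rule Lim_transform_eventually)
    then have "((\<lambda>t. (g t - x0) /\<^sub>R t) \<longlongrightarrow> d) (at 0)"
      using LIM_zero_cancel tendsto_norm_zero_iff by blast
    then show "((\<lambda>t. (g t - x0) /\<^sub>R t) \<longlongrightarrow> d) (at_right 0)"
      by (rule filterlim_mono) (auto simp: at_le)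
  next
    have "((\<lambda>t. t *\<^sub>R d) \<longlongrightarrow> 0 *\<^sub>R d) (at_right (0::real))"
      by (intro tendsto_intros)
    then have "\<forall>\<^sub>F t in at_right (0::real). t *\<^sub>R d \<in> W"
      using W(1,2) G0 by (auto dest: topological_tendstoD)
    then show "\<forall>\<^sub>F t in at_right 0. \<forall>v\<in>V. v \<bullet> (F (g t) - F x0) = t * (v \<bullet> ?A d)"
    proof eventually_elim
      case (elim t)
      then have "G (g t) = t *\<^sub>R d"
        using hom by (simp add: g_def homeomorphism_apply2)
      then have "v \<bullet> ?A (t *\<^sub>R d) = v \<bullet> ?A (G (g t))" for v
        by simp
      \<comment> \<open>By \<open>AR\<close> the correction contributes
        \<open>v \<bullet> (F (g t) - F x0 - ?A (g t - x0))\<close>, and its last term cancels the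
        linear part of \<open>G\<close>.\<close>
      moreover have "v \<bullet> ?A (G (g t)) = v \<bullet> (F (g t) - F x0)" if "v \<in> V" for v
        unfolding G_def by (simp add: blinfun.add_right inner_add_right AR[OF that] inner_diff_right)
      ultimately show ?case
        by (simp add: blinfun.scaleR_right)
    qed
  qed
qed

section \<open>Necessary conditions for minimality along a curve\<close>

text \<open>In the applications \<open>e\<close> is the tolerance in the definition of
  differentiability and \<open>c\<close> is \<open>norm d\<close> or its square, so each limit
  argument may be run with \<open>e\<close> fixed.\<close>

lemma nonneg_if_ge_small_negative:
  fixes x c :: real
  assumes "\<And>e. e > 0 \<Longrightarrow> - e * c \<le> x"
  shows "0 \<le> x"
proof (rule tendsto_upperbound)
  have "((\<lambda>e. - e * c) \<longlongrightarrow> - 0 * c) (at_right 0)"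
    by (intro tendsto_intros)
  then show "((\<lambda>e. - e * c) \<longlongrightarrow> 0) (at_right 0)"
    by simp
  show "\<forall>\<^sub>F e in at_right 0. - e * c \<le> x"
    using eventually_at_right_less[of "0::real"] by eventually_elim (rule assms)
qed (rule trivial_limit_at_right_real)

lemma tendsto_of_difference_quotient:
  fixes g :: "real \<Rightarrow> 'a::real_normed_vector"
  assumes "((\<lambda>t. (g t - x0) /\<^sub>R t) \<longlongrightarrow> d) (at_right 0)"
  shows "(g \<longlongrightarrow> x0) (at_right 0)"
proof -
  have "((\<lambda>t. x0 + t *\<^sub>R ((g t - x0) /\<^sub>R t)) \<longlongrightarrow> x0 + 0 *\<^sub>R d) (at_right 0)"
    by (intro tendsto_intros assms)
  then have "((\<lambda>t. x0 + t *\<^sub>R ((g t - x0) /\<^sub>R t)) \<longlongrightarrow> x0) (at_right 0)"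
    by simp
  then show ?thesis
    by (rule Lim_transform_eventually) (auto simp: eventually_at_filter)
qed

text \<open>Differentiability and minimality give
  \<open>- e * norm (g t - x0) \<le> h' (g t - x0)\<close> for small positive \<open>t\<close>;
  divide by \<open>t\<close> and pass to the limit.\<close>

lemma first_order_along_curve:
  fixes h :: "'a::real_normed_vector \<Rightarrow> real"
  assumes h: "(h has_derivative h') (at x0)"
    and g: "((\<lambda>t. (g t - x0) /\<^sub>R t) \<longlongrightarrow> d) (at_right 0)"
    and min: "\<forall>\<^sub>F t in at_right 0. h x0 \<le> h (g t)"
  shows "0 \<le> h' d"
proof (rule nonneg_if_ge_small_negative)
  have bl: "bounded_linear h'"
    using h by (rule has_derivative_bounded_linear)
  show "- e * norm d \<le> h' d" if "e > 0" for e :: real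
  proof (rule tendsto_le)
    let ?u = "\<lambda>t. (g t - x0) /\<^sub>R t"
    show "((\<lambda>t. h' (?u t)) \<longlongrightarrow> h' d) (at_right 0)"
      by (intro bounded_linear.tendsto[OF bl] g)
    show "((\<lambda>t. - e * norm (?u t)) \<longlongrightarrow> - e * norm d) (at_right 0)"
      by (intro tendsto_intros g)
    obtain s where "s > 0" and s: "\<And>y. norm (y - x0) < s \<Longrightarrow>
        norm (h y - h x0 - h' (y - x0)) \<le> e * norm (y - x0)"
      using h \<open>e > 0\<close> unfolding has_derivative_at_alt by blast
    have "\<forall>\<^sub>F t in at_right 0. dist (g t) x0 < s"
      using tendsto_of_difference_quotient[OF g] \<open>s > 0\<close> by (rule tendstoD)
    moreover have "\<forall>\<^sub>F t in at_right 0. (0::real) < t"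
      by (simp add: eventually_at_right_less)
    ultimately show "\<forall>\<^sub>F t in at_right 0. - e * norm (?u t) \<le> h' (?u t)"
      using min
    proof eventually_elim
      case (elim t)
      then have "\<bar>h (g t) - h x0 - h' (g t - x0)\<bar> \<le> e * norm (g t - x0)"
        using s[of "g t"] by (simp add: dist_norm)
      then have "- (e * norm (g t - x0)) \<le> h' (g t - x0)"
        using elim by linarith
      then have "inverse t * (- (e * norm (g t - x0))) \<le> inverse t * h' (g t - x0)"
        using elim by (intro mult_left_mono) auto
      then show ?case
        using elim by (simp add: linear_simps[OF bl] mult.left_commute)
    qed
  qed (rule trivial_limit_at_right_real)
qed

text \<open>The curve is known only to first order, which suffices because \<open>h' x0 = 0\<close>
  removes the linear term. The mean value theorem on the segment from \<open>x0\<close> to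
  \<open>g t\<close>, combined with differentiability of \<open>h'\<close> at \<open>x0\<close>,
  replaces a Taylor expansion.\<close>

lemma second_order_along_curve:
  fixes h :: "'a::real_normed_vector \<Rightarrow> real"
  assumes h: "\<And>x. (h has_derivative blinfun_apply (h' x)) (at x)"
    and h': "(h' has_derivative h'') (at x0)"
    and crit: "h' x0 = 0"
    and g: "((\<lambda>t. (g t - x0) /\<^sub>R t) \<longlongrightarrow> d) (at_right 0)"
    and min: "\<forall>\<^sub>F t in at_right 0. h x0 \<le> h (g t)"
  shows "0 \<le> blinfun_apply (h'' d) d"
proof (rule nonneg_if_ge_small_negative)
  have bl: "bounded_linear h''"
    using h' by (rule has_derivative_bounded_linear)
  show "- e * (norm d)\<^sup>2 \<le> h'' d d" if "e > 0" for e :: real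
  proof (rule tendsto_le)
    let ?u = "\<lambda>t. (g t - x0) /\<^sub>R t"
    show "((\<lambda>t. h'' (?u t) (?u t)) \<longlongrightarrow> h'' d d) (at_right 0)"
      by (intro tendsto_intros bounded_linear.tendsto[OF bl] g)
    show "((\<lambda>t. - e * (norm (?u t))\<^sup>2) \<longlongrightarrow> - e * (norm d)\<^sup>2) (at_right 0)"
      by (intro tendsto_intros g)
    obtain s where "s > 0" and s: "\<And>y. norm (y - x0) < s \<Longrightarrow>
        norm (h' y - h' x0 - h'' (y - x0)) \<le> e * norm (y - x0)"
      using h' \<open>e > 0\<close> unfolding has_derivative_at_alt by blast
    have "\<forall>\<^sub>F t in at_right 0. dist (g t) x0 < s"
      using tendsto_of_difference_quotient[OF g] \<open>s > 0\<close> by (rule tendstoD)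
    moreover have "\<forall>\<^sub>F t in at_right 0. (0::real) < t"
      by (simp add: eventually_at_right_less)
    ultimately show "\<forall>\<^sub>F t in at_right 0. - e * (norm (?u t))\<^sup>2 \<le> h'' (?u t) (?u t)"
      using min
    proof eventually_elim
      case (elim t)
      define w where "w = g t - x0"
      have "\<exists>\<theta>\<in>{0<..<1}. h (x0 + 1 *\<^sub>R w) - h (x0 + 0 *\<^sub>R w) = h' (x0 + \<theta> *\<^sub>R w) ((1 - 0) *\<^sub>R w)"
      proof (rule mvt_simple)
        fix \<theta> :: real
        have "((\<lambda>\<theta>. x0 + \<theta> *\<^sub>R w) has_derivative (\<lambda>\<theta>. \<theta> *\<^sub>R w)) (at \<theta> within {0..1})"
          by (auto intro!: derivative_eq_intros)
        from has_derivative_compose[OF this h]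
        show "((\<lambda>\<theta>. h (x0 + \<theta> *\<^sub>R w)) has_derivative (\<lambda>u. h' (x0 + \<theta> *\<^sub>R w) (u *\<^sub>R w)))
            (at \<theta> within {0..1})" .
      qed simp
      then obtain \<theta> where \<theta>: "0 < \<theta>" "\<theta> < 1" and "h (g t) - h x0 = h' (x0 + \<theta> *\<^sub>R w) w"
        by (auto simp: w_def)
      then have nonneg: "0 \<le> h' (x0 + \<theta> *\<^sub>R w) w"
        using elim by simp
      have "norm (\<theta> *\<^sub>R w) < s"
      proof -
        have "\<theta> * norm w \<le> norm w"
          using \<theta> by (simp add: mult_left_le_one_le)
        then show ?thesis
          using elim \<theta> by (simp add: w_def dist_norm)
      qed
      then have "norm (h' (x0 + \<theta> *\<^sub>R w) - h'' (\<theta> *\<^sub>R w)) \<le> e * norm (\<theta> *\<^sub>R w)"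
        using s[of "x0 + \<theta> *\<^sub>R w"] crit by simp
      then have "norm ((h' (x0 + \<theta> *\<^sub>R w) - h'' (\<theta> *\<^sub>R w)) w) \<le> e * norm (\<theta> *\<^sub>R w) * norm w"
        by (meson mult_right_mono norm_blinfun norm_ge_zero order_trans)
      then have "\<bar>h' (x0 + \<theta> *\<^sub>R w) w - \<theta> * h'' w w\<bar> \<le> \<theta> * (e * (norm w)\<^sup>2)"
        using \<theta> by (simp add: linear_simps[OF bl] blinfun.diff_left blinfun.scaleR_right blinfun.scaleR_left
            power2_eq_square mult_ac)
      \<comment> \<open>The unknown \<theta> scales the quadratic term and the error bound alike, so
        it can be cancelled.\<close>
      then have "\<theta> * (- e * (norm w)\<^sup>2) \<le> \<theta> * h'' w w"
        using nonneg by simp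
      then have "- e * (norm w)\<^sup>2 \<le> h'' w w"
        using \<theta> by (simp only: mult_le_cancel_left_pos)
      then have "(inverse t)\<^sup>2 * (- e * (norm w)\<^sup>2) \<le> (inverse t)\<^sup>2 * h'' w w"
        by (intro mult_left_mono) auto
      then show ?case
        using elim unfolding w_def[symmetric]
        by (simp add: linear_simps[OF bl] blinfun.scaleR_right blinfun.scaleR_left power2_eq_square mult_ac)
    qed
  qed (rule trivial_limit_at_right_real)
qed

section \<open>The multiplier and the second-order condition\<close>

theorem theorem4p2:
  fixes f :: "real ^ 'n \<Rightarrow> real"
    and F :: "real ^ 'n \<Rightarrow> real ^ 'm"
    and r :: nat
    and D :: "nat \<Rightarrow> (real ^ 'm) set"
    and xbar :: "real ^ 'n"
  assumes "twice_cont_differentiable f"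
    and "twice_cont_differentiable F"
    and "\<And>i. i \<in> {1..r} \<Longrightarrow> polyhedron (D i)"
    and "local_minimizer_on f (feasible_set F r D) xbar"
    and "MPDC_LICQ F r D xbar"
  shows "\<exists>lbar. S_multipliers f F r D xbar = {lbar} \<and>
           (\<forall>d\<in>critical_cone f F r D xbar.
              d \<bullet> (hessian (\<lambda>x. lagrangian f F x lbar) xbar *v d) \<ge> 0)"
proof -
  obtain f1 f2 where f1: "\<And>x. (f has_derivative blinfun_apply (f1 x)) (at x)"
    and f2: "\<And>x. (f1 has_derivative blinfun_apply (f2 x)) (at x)"
    using assms(1) unfolding twice_cont_differentiable_def by blast
  obtain F1 F2 where F1: "\<And>x. (F has_derivative blinfun_apply (F1 x)) (at x)"
    and F2: "\<And>x. (F1 has_derivative blinfun_apply (F2 x)) (at x)"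
    using assms(2) unfolding twice_cont_differentiable_def by blast
  have contF1: "continuous_on UNIV F1"
    using F2 has_derivative_continuous continuous_at_imp_continuous_on by blast
  let ?A = "blinfun_apply (F1 xbar)" and ?y = "F xbar"
  let ?I = "active_indices F r D xbar"
  define N where "N i = frechet_normal_cone (D i) ?y" for i
  define V where "V = (\<Sum>i\<in>?I. span (N i))"
  have linA: "linear ?A"
    by (simp add: blinfun.bounded_linear_right bounded_linear.linear)
  have linAt: "linear (adjoint ?A)"
    using adjoint_linear[OF linA] .
  have "F differentiable (at xbar)"
    using F1 by (auto simp: differentiable_def)
  then have jacobian: "(\<lambda>d. jacobian F (at xbar) *v d) = ?A"
    using F1 jacobian_works has_derivative_unique by blast
  have adjoint: "transpose (jacobian F (at xbar)) *v l = adjoint ?A l" for l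
    using adjoint_matrix[of "jacobian F (at xbar)"] unfolding jacobian by metis
  have adj: "adjoint ?A l \<bullet> d = l \<bullet> ?A d" for l d
    using adjoint_works[OF linA] by (simp add: inner_commute)
  have finI: "finite ?I"
    by (simp add: active_indices_def)
  have subspace_V: "subspace V"
    unfolding V_def using finI by (intro subspace_sum_subspaces) auto
  have N_V: "N i \<subseteq> V" if "i \<in> ?I" for i
    using subset_sum_subspaces[of ?I "\<lambda>i. span (N i)" i] finI that span_superset
    unfolding V_def by blast
  have LICQ: "l = 0" if "l \<in> V" "adjoint ?A l = 0" for l
    using assms(5) that unfolding MPDC_LICQ_def V_def N_def adjoint by blast
  obtain \<epsilon> where "\<epsilon> > 0"
    and xbar: "\<And>z. z \<in> feasible_set F r D \<Longrightarrow> dist xbar z < \<epsilon> \<Longrightarrow> f xbar \<le> f z"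
    and feasible: "xbar \<in> feasible_set F r D"
    using assms(4) unfolding local_minimizer_on_def by (auto simp: ball_def)

  \<comment> \<open>As \<open>J\<close> lies in \<open>V\<close>, each
    \<open>a \<bullet> (F (g t) - ?y)\<close> equals \<open>t * (a \<bullet> ?A d)\<close>, which is
    nonpositive. Hence the curve stays feasible for small \<open>t\<close>, and local minimality of
    \<open>xbar\<close> applies along it.\<close>
  have curve: "\<exists>g. ((\<lambda>t. (g t - xbar) /\<^sub>R t) \<longlongrightarrow> d) (at_right 0) \<and>
      (\<forall>\<^sub>F t in at_right 0. \<forall>v\<in>V. v \<bullet> (F (g t) - ?y) = t * (v \<bullet> ?A d)) \<and>
      (\<forall>\<^sub>F t in at_right 0. f xbar \<le> f (g t))"
    if i: "i \<in> ?I" and "J \<subseteq> N i" and d: "\<And>a. a \<in> J \<Longrightarrow> a \<bullet> ?A d \<le> 0"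
      and J: "\<forall>\<^sub>F z in nhds ?y. (\<forall>a\<in>J. a \<bullet> (z - ?y) \<le> 0) \<longrightarrow> z \<in> D i"
    for i J d
  proof -
    obtain g where g: "((\<lambda>t. (g t - xbar) /\<^sub>R t) \<longlongrightarrow> d) (at_right 0)"
      and gV: "\<forall>\<^sub>F t in at_right 0. \<forall>v\<in>V. v \<bullet> (F (g t) - ?y) = t * (v \<bullet> ?A d)"
      using curve_with_prescribed_components[OF F1 contF1 subspace_V LICQ] by blast
    have lim: "(g \<longlongrightarrow> xbar) (at_right 0)"
      using g by (rule tendsto_of_difference_quotient)
    have "isCont F xbar"
      using F1 by (rule has_derivative_continuous)
    then have "((\<lambda>t. F (g t)) \<longlongrightarrow> ?y) (at_right 0)"
      using lim by (rule isCont_tendsto_compose)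
    then have "\<forall>\<^sub>F t in at_right 0. (\<forall>a\<in>J. a \<bullet> (F (g t) - ?y) \<le> 0) \<longrightarrow> F (g t) \<in> D i"
      using J by (rule eventually_compose_filterlim[rotated])
    moreover have "\<forall>\<^sub>F t in at_right 0. (0::real) < t"
      by (simp add: eventually_at_right_less)
    moreover have "\<forall>\<^sub>F t in at_right 0. dist (g t) xbar < \<epsilon>"
      using lim \<open>\<epsilon> > 0\<close> by (rule tendstoD)
    ultimately have "\<forall>\<^sub>F t in at_right 0. f xbar \<le> f (g t)"
      using gV
    proof eventually_elim
      case (elim t)
      have "a \<bullet> (F (g t) - ?y) \<le> 0" if "a \<in> J" for a
      proof -
        have "a \<in> V"
          using that \<open>J \<subseteq> N i\<close> N_V[OF i] by blast
        then show ?thesis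
          using elim d[OF that] by (simp add: mult_nonneg_nonpos)
      qed
      then have "F (g t) \<in> D i"
        using elim by blast
      then have "g t \<in> feasible_set F r D"
        using i by (auto simp: feasible_set_def disj_union_def active_indices_def)
      then show ?case
        using xbar elim by (simp add: dist_commute)
    qed
    with g gV show ?thesis by blast
  qed

  have active_normals: "\<exists>J. finite J \<and> J \<subseteq> N i \<and>
      (\<forall>\<^sub>F z in nhds ?y. (\<forall>a\<in>J. a \<bullet> (z - ?y) \<le> 0) \<longrightarrow> z \<in> D i)" if "i \<in> ?I" for i
  proof -
    have "polyhedron (D i)" "?y \<in> D i"
      using that assms(3) by (auto simp: active_indices_def)
    then show ?thesis
      unfolding N_def by (rule polyhedron_active_normals) blast
  qed

  \<comment> \<open>Were the negative gradient outside the cone generated by the images of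
    \<open>J\<close>, Farkas' lemma would yield a direction of descent satisfying the linearized
    constraints, and the curve along it would contradict minimality.\<close>
  have multiplier: "\<exists>l\<in>N i. gradient f xbar + adjoint ?A l = 0" if i: "i \<in> ?I" for i
  proof -
    obtain J where "finite J" and JN: "J \<subseteq> N i"
      and J: "\<forall>\<^sub>F z in nhds ?y. (\<forall>a\<in>J. a \<bullet> (z - ?y) \<le> 0) \<longrightarrow> z \<in> D i"
      using active_normals[OF i] by blast
    have "- gradient f xbar \<in> convex_cone hull (adjoint ?A ` J)"
    proof (rule ccontr)
      assume "- gradient f xbar \<notin> convex_cone hull (adjoint ?A ` J)"
      then obtain d where d: "\<And>a. a \<in> adjoint ?A ` J \<Longrightarrow> a \<bullet> d \<le> 0"
        and neg: "- gradient f xbar \<bullet> d > 0"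
        using farkas \<open>finite J\<close> by (metis finite_imageI)
      have "a \<bullet> ?A d \<le> 0" if "a \<in> J" for a
        using d[of "adjoint ?A a"] that by (simp add: adj)
      from curve[OF i JN this J] obtain g
        where "((\<lambda>t. (g t - xbar) /\<^sub>R t) \<longlongrightarrow> d) (at_right 0)"
          and "\<forall>\<^sub>F t in at_right 0. f xbar \<le> f (g t)"
        by blast
      from first_order_along_curve[OF f1 this] show False
        using neg by (simp add: gradient_inner[OF f1])
    qed
    then obtain l where "l \<in> convex_cone hull J" "- gradient f xbar = adjoint ?A l"
      by (auto simp: convex_cone_hull_linear_image[OF linAt])
    moreover have "convex_cone hull J \<subseteq> N i"
      using JN unfolding N_def by (intro hull_minimal convex_cone_frechet_normal_cone)
    ultimately show ?thesis
      by (metis add.left_inverse neg_equal_iff_equal minus_minus subsetD add.commute)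
  qed
  have unique: "l = l'" if "l \<in> V" "l' \<in> V" "gradient f xbar + adjoint ?A l = 0"
      "gradient f xbar + adjoint ?A l' = 0" for l l'
  proof -
    have "adjoint ?A (l - l') = 0"
      using that by (simp add: linear_diff[OF linAt] add_eq_0_iff)
    then have "l - l' = 0"
      using that subspace_V by (intro LICQ subspace_diff)
    then show ?thesis by simp
  qed
  \<comment> \<open>An active index ensures that a multiplier exists, and that every S-stationarity
    multiplier lies in \<open>N i0\<close> and thus in \<open>V\<close>, where uniqueness
    holds.\<close>
  obtain i0 where i0: "i0 \<in> ?I"
    using feasible by (auto simp: feasible_set_def disj_union_def active_indices_def)
  obtain l where l: "l \<in> N i0" "gradient f xbar + adjoint ?A l = 0"
    using multiplier[OF i0] by blast
  \<comment> \<open>The multiplier found for \<open>i\<close> lies in \<open>V\<close> as well, so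
    it is \<open>l\<close> itself.\<close>
  have l_N: "l \<in> N i" if i: "i \<in> ?I" for i
    using multiplier[OF i] unique l N_V i i0 by (metis subsetD)

  define L1 where "L1 k x = f1 x + (blinfun_inner_left k o\<^sub>L F1 x)" for k x
  have L1: "((\<lambda>x. lagrangian f F x k) has_derivative blinfun_apply (L1 k x)) (at x)" for k x
    unfolding lagrangian_def L1_def
    by (auto intro!: derivative_eq_intros f1 F1 simp: blinfun.add_left inner_commute)
  have L2: "(L1 k has_derivative (\<lambda>e. f2 x e + (blinfun_inner_left k o\<^sub>L F2 x e))) (at x)" for k x
    unfolding L1_def
    by (intro has_derivative_add f2 bounded_linear.has_derivative[OF _ F2]
        bounded_bilinear.bounded_linear_right[OF bounded_bilinear_blinfun_compose])
  have grad_L: "gradient (\<lambda>x. lagrangian f F x k) xbar = gradient f xbar + adjoint ?A k" for k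
  proof (rule euclidean_eqI)
    fix b :: "real ^ 'n"
    show "gradient (\<lambda>x. lagrangian f F x k) xbar \<bullet> b = (gradient f xbar + adjoint ?A k) \<bullet> b"
      by (simp add: gradient_inner[OF L1] gradient_inner[OF f1] inner_add_left adj L1_def
          blinfun.add_left inner_commute[of k])
  qed
  have S: "S_multipliers f F r D xbar = {l}"
  proof
    show "S_multipliers f F r D xbar \<subseteq> {l}"
      unfolding S_multipliers_def grad_L N_def[symmetric]
      using unique l N_V i0 by blast
    show "{l} \<subseteq> S_multipliers f F r D xbar"
      unfolding S_multipliers_def grad_L N_def[symmetric] using l l_N by blast
  qed
  have "0 \<le> d \<bullet> (hessian (\<lambda>x. lagrangian f F x l) xbar *v d)"
    if "d \<in> critical_cone f F r D xbar" for d
  proof -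
    have "?A d \<in> tangent_cone (disj_union r D) ?y" and descent: "gradient f xbar \<bullet> d \<le> 0"
      using that jacobian unfolding critical_cone_def linearization_cone_def by (auto simp: fun_eq_iff)
    moreover have "closed (D j)" if "j \<in> {1..r}" for j
      using assms(3)[OF that] by (rule polyhedron_imp_closed)
    ultimately obtain i where i: "i \<in> ?I" and tangent: "?A d \<in> tangent_cone (D i) ?y"
      using tangent_cone_disj_union[of r D "?A d" ?y] unfolding active_indices_def by blast
    have normal: "a \<bullet> ?A d \<le> 0" if "a \<in> N i" for a
      using that tangent unfolding N_def frechet_normal_cone_def by blast
    have "gradient f xbar \<bullet> d + l \<bullet> ?A d = 0"
      using l(2) by (simp add: adj[symmetric] inner_add_left[symmetric])
    \<comment> \<open>Both summands are nonpositive, the first by criticality of \<open>d\<close>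
      and the second because \<open>l\<close> is normal to \<open>D i\<close> while
      \<open>?A d\<close> is tangent; their sum is zero, so both vanish.\<close>
    then have l_d: "l \<bullet> ?A d = 0"
      using descent normal[OF l_N[OF i]] by linarith
    obtain J where JN: "J \<subseteq> N i"
      and J: "\<forall>\<^sub>F z in nhds ?y. (\<forall>a\<in>J. a \<bullet> (z - ?y) \<le> 0) \<longrightarrow> z \<in> D i"
      using active_normals[OF i] by blast
    have "a \<bullet> ?A d \<le> 0" if "a \<in> J" for a
      using JN normal that by blast
    from curve[OF i JN this J] obtain g
      where g: "((\<lambda>t. (g t - xbar) /\<^sub>R t) \<longlongrightarrow> d) (at_right 0)"
        and gV: "\<forall>\<^sub>F t in at_right 0. \<forall>v\<in>V. v \<bullet> (F (g t) - ?y) = t * (v \<bullet> ?A d)"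
        and gf: "\<forall>\<^sub>F t in at_right 0. f xbar \<le> f (g t)"
      by blast
    have l_V: "l \<in> V"
      using l(1) N_V[OF i0] by blast
    from gV gf have "\<forall>\<^sub>F t in at_right 0. lagrangian f F xbar l \<le> lagrangian f F (g t) l"
    proof eventually_elim
      case (elim t)
      \<comment> \<open>As \<open>l\<close> lies in \<open>V\<close>, this product equals
        \<open>t * (l \<bullet> ?A d)\<close>, so the constraint term of the Lagrangian is constant
        along the curve.\<close>
      then have "l \<bullet> (F (g t) - ?y) = 0"
        using l_V l_d by simp
      then show ?case
        using elim by (simp add: lagrangian_def inner_diff_right inner_commute)
    qed
    moreover have "L1 l xbar = 0"
    proof (rule blinfun_eqI)
      fix e
      show "L1 l xbar e = blinfun_apply 0 e"
        using gradient_inner[OF L1, of l xbar e] grad_L[of l] l(2) by simp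
    qed
    ultimately show ?thesis
      using second_order_along_curve[OF L1 L2 _ g] hessian_inner[OF L1 L2] by simp
  qed
  with S show ?thesis by blast
qed

end
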